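(* Let $m\ge1$ and $X=\{x_0,x_1,\dots,x_m\}$. For any $c\in\mathbb{R}^m_{GC}\langle\langle X\rangle\rangle$ with growth constants $K_c,M_c>0$, i.e., $|(c,\eta)|\le K_cM_c^{|\eta|}$ for all $\eta\in X^*$, it follows that $$|(c^{-1},\eta)|\le K\,(\mathcal{B}(K_c)M_c)^{|\eta|}\,|\eta|!,\qquad\forall\eta\in X^*,$$ for some $K>0$, where $$\mathcal{B}(K_c)=\frac{1}{\ln\left(1+\frac{1}{mK_c}\right)}.$$ Therefore $c^{-1}\in\mathbb{R}^m_{LC}\langle\langle X\rangle\rangle$. Furthermore, no geometric growth constant smaller than $\mathcal{B}(K_c)M_c$ can satisfy this bound for the whole class of series with growth constants $K_c,M_c$: for all $K_c,M_c>0$ and every $0<M'<\mathcal{B}(K_c)M_c$ there is a series $c\in\mathbb{R}^m_{GC}\langle\langle X\rangle\rangle$ with $|(c,\eta)|\le K_cM_c^{|\eta|}$ for all $\eta$ such that there is no $K>0$ with $|(c^{-1},\eta)|\le K(M')^{|\eta|}|\eta|!$ for all $\eta\in X^*$. Hence the radius of convergence for the composition inverse operation is $1/(\mathcal{B}(K_c)M_c(m+1))$.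
   Context: $X^*$ is the monoid of words over the alphabet $X$ of noncommuting letters, including the empty word $\emptyset$; $|\eta|$ is word length. $\mathbb{R}^m\langle\langle X\rangle\rangle$ is the set of formal power series $c:X^*\to\mathbb{R}^m$, $c=\sum_\eta(c,\eta)\eta$, with component series $c_i$; $|z|=\max_i|z_i|$ for $z\in\mathbb{R}^m$. $\mathbb{R}^m_{LC}\langle\langle X\rangle\rangle$ (locally convergent series) is the set of $c$ for which there are $K_c,M_c>0$ with $|(c,\eta)|\le K_cM_c^{|\eta|}|\eta|!$ for all $\eta\in X^*$; $\mathbb{R}^m_{GC}\langle\langle X\rangle\rangle$ (globally convergent series) is the set of $c$ for which there are $K_c,M_c>0$ with $|(c,\eta)|\le K_cM_c^{|\eta|}$ for all $\eta\in X^*$. In each case $M_c$ is called a geometric growth constant. When $M$ is the smallest geometric growth constant valid (in the local bound $K M^{|\eta|}|\eta|!$) for a class of series, the number $1/(M(m+1))$ is called the radius of convergence for the class. The shuffle product $\sqcup\!\sqcup$ is the bilinear product with $(x_i\eta)\sqcup\!\sqcup(x_j\xi)=x_i(\eta\sqcup\!\sqcup(x_j\xi))+x_j((x_i\eta)\sqcup\!\sqcup\xi)$ and $\eta\sqcup\!\sqcup\emptyset=\emptyset\sqcup\!\sqcup\eta=\eta$. The modified composition product of $c,d\in\mathbb{R}^m\langle\langle X\rangle\rangle$ is $c\,\tilde\circ\,d=\sum_{\eta\in X^*}(c,\eta)\,\phi_d(\eta)(1)$, where $\phi_d$ is the continuous (in the ultrametric sense) algebra homomorphism from $\mathbb{R}\langle\langle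 X\rangle\rangle$ to $\mathrm{End}(\mathbb{R}\langle\langle X\rangle\rangle)$ with $\phi_d(x_i\eta)=\phi_d(x_i)\circ\phi_d(\eta)$, $\phi_d(x_i)(e)=x_ie+x_0(d_i\sqcup\!\sqcup e)$ for $i=0,\dots,m$ with $d_0:=0$, and $\phi_d(\emptyset)=\mathrm{id}$. On formal elements $c_\delta=\delta+c$, $c\in\mathbb{R}^m\langle\langle X\rangle\rangle$ ($\delta$ a symbol representing the identity operator), the product $c_\delta\circ d_\delta=\delta+d+c\,\tilde\circ\,d$ defines a group with identity $\delta$. The composition inverse $c^{-1}$ of $c$ is the series with $(\delta+c)^{-1}=\delta+c^{-1}$ in this group; equivalently, $c^{-1}$ is the unique series satisfying $c^{-1}=(-c)\,\tilde\circ\,c^{-1}$. *)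

theory Defs
  imports "HOL-Analysis.Analysis" "HOL-Algebra.Group" "HOL-Library.Multiset"
begin

text \<open>
  The alphabet has the letters \<open>x\<^sub>0 = None\<close> and \<open>x\<^sub>i = Some i\<close> for \<open>i :: 'm\<close>, where \<open>'m\<close> is a finite
  (hence nonempty) index type, so that \<open>m = CARD('m) \<ge> 1\<close>.
\<close>

type_synonym 'm letter = "'m option"
type_synonym 'm word = "'m letter list"
type_synonym 'm series = "'m word \<Rightarrow> real"
type_synonym 'm vseries = "'m word \<Rightarrow> real ^ 'm"

text \<open>On \<open>real ^ 'm\<close>, the library's \<open>infnorm\<close> is the maximum of the absolute values of the components.\<close>

definition GC_series :: "'m::finite vseries set" where
  "GC_series = {c. \<exists>K>0. \<exists>M>0. \<forall>\<eta>. infnorm (c \<eta>) \<le> K * M ^ length \<eta>}"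

definition LC_series :: "'m::finite vseries set" where
  "LC_series = {c. \<exists>K>0. \<exists>M>0. \<forall>\<eta>. infnorm (c \<eta>) \<le> K * M ^ length \<eta> * fact (length \<eta>)}"

text \<open>
  The shuffle of two words is a sum of words with multiplicities, i.e. a multiset of words (the
  library's \<open>shuffles\<close> forgets the multiplicities).
\<close>

fun shuffle_words :: "'a list \<Rightarrow> 'a list \<Rightarrow> 'a list multiset" where
  "shuffle_words \<eta> [] = {#\<eta>#}"
| "shuffle_words [] \<xi> = {#\<xi>#}"
| "shuffle_words (x # \<eta>) (y # \<xi>) =
     image_mset ((#) x) (shuffle_words \<eta> (y # \<xi>)) +
     image_mset ((#) y) (shuffle_words (x # \<eta>) \<xi>)"

lemma length_shuffle_words:
  "\<nu> \<in># shuffle_words \<eta> \<xi> \<Longrightarrow> length \<nu> = length \<eta> + length \<xi>"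
  by (induction \<eta> \<xi> arbitrary: \<nu> rule: shuffle_words.induct) auto

text \<open>
  By the preceding lemma, only the pairs of words below contribute to the coefficient of \<open>\<nu>\<close> in the
  bilinear extension to series.
\<close>

definition shuffle :: "'m::finite series \<Rightarrow> 'm series \<Rightarrow> 'm series" where
  "shuffle a b = (\<lambda>\<nu>. \<Sum>(\<eta>, \<xi>) \<in> {(\<eta>, \<xi>). length \<eta> + length \<xi> = length \<nu>}.
     a \<eta> * b \<xi> * real (count (shuffle_words \<eta> \<xi>) \<nu>))"

lemma finite_shuffle_support:
  "finite {(\<eta> :: 'm::finite word, \<xi> :: 'm word). length \<eta> + length \<xi> = n}"
proof (rule finite_subset)
  show "{(\<eta> :: 'm word, \<xi> :: 'm word). length \<eta> + length \<xi> = n}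
    \<subseteq> {\<eta>. set \<eta> \<subseteq> UNIV \<and> length \<eta> \<le> n} \<times> {\<xi>. set \<xi> \<subseteq> UNIV \<and> length \<xi> \<le> n}"
    by auto
qed (intro finite_cartesian_product finite_lists_length_le finite)

definition one_series :: "'m series" where
  "one_series = (\<lambda>\<eta>. if \<eta> = [] then 1 else 0)"

definition letter_mult :: "'m letter \<Rightarrow> 'm series \<Rightarrow> 'm series" where
  "letter_mult x e = (\<lambda>\<eta>. case \<eta> of [] \<Rightarrow> 0 | y # \<xi> \<Rightarrow> if y = x then e \<xi> else 0)"

definition component :: "'m::finite vseries \<Rightarrow> 'm letter \<Rightarrow> 'm series" where
  "component d x = (\<lambda>\<eta>. case x of None \<Rightarrow> 0 | Some i \<Rightarrow> d \<eta> $ i)"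

definition phi_letter :: "'m::finite vseries \<Rightarrow> 'm letter \<Rightarrow> 'm series \<Rightarrow> 'm series" where
  "phi_letter d x e =
     (\<lambda>\<eta>. letter_mult x e \<eta> + letter_mult None (shuffle (component d x) e) \<eta>)"

primrec phi :: "'m::finite vseries \<Rightarrow> 'm word \<Rightarrow> 'm series \<Rightarrow> 'm series" where
  "phi d [] = id"
| "phi d (x # \<eta>) = phi_letter d x \<circ> phi d \<eta>"

lemma phi_one_eq_0: "length \<nu> < length \<eta> \<Longrightarrow> phi d \<eta> one_series \<nu> = 0"
proof (induction \<eta> arbitrary: \<nu>)
  case (Cons x \<eta>)
  have sh: "shuffle b (phi d \<eta> one_series) \<xi> = 0" if "length \<xi> < length \<eta>" for b \<xi>
    unfolding shuffle_def using that by (intro sum.neutral) (auto simp: Cons.IH)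
  show ?case
    using Cons.prems by (auto simp: phi_letter_def letter_mult_def Cons.IH sh split: list.split)
qed simp

text \<open>
  The modified composition product, where the locally finite sum over all words \<open>\<eta>\<close> reduces to a finite
  sum for each coefficient by the preceding lemma.
\<close>

definition mod_comp :: "'m::finite vseries \<Rightarrow> 'm vseries \<Rightarrow> 'm vseries" where
  "mod_comp c d = (\<lambda>\<nu>. \<Sum>\<eta> | length \<eta> \<le> length \<nu>. phi d \<eta> one_series \<nu> *\<^sub>R c \<eta>)"

lemma finite_words_length_le: "finite {\<eta> :: 'm::finite word. length \<eta> \<le> n}"
  using finite_lists_length_le[of "UNIV :: 'm letter set" n] by simp

text \<open>The series \<open>c\<close> stands for the formal element \<open>\<delta> + c\<close>; in particular \<open>0\<close> stands for \<open>\<delta>\<close>.\<close>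

definition delta_group :: "'m::finite vseries monoid" where
  "delta_group =
     \<lparr>carrier = UNIV, mult = (\<lambda>c d \<eta>. d \<eta> + mod_comp c d \<eta>), one = (\<lambda>\<eta>. 0)\<rparr>"

definition comp_inverse :: "'m::finite vseries \<Rightarrow> 'm vseries" where
  "comp_inverse c = inv\<^bsub>delta_group\<^esub> c"

definition \<B> :: "nat \<Rightarrow> real \<Rightarrow> real" where
  "\<B> m K = 1 / ln (1 + 1 / (real m * K))"

text \<open>
  A geometric growth constant for a class of series has to work for every member, whereas the factor
  \<open>K\<close> may depend on the member.
\<close>

definition geometric_growth_constant :: "'m::finite vseries set \<Rightarrow> real \<Rightarrow> bool" where
  "geometric_growth_constant C M \<longleftrightarrow> M > 0 \<and>
     (\<forall>c\<in>C. \<exists>K>0. \<forall>\<eta>. infnorm (c \<eta>) \<le> K * M ^ length \<eta> * fact (length \<eta>))"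

definition has_radius_of_convergence :: "'m::finite vseries set \<Rightarrow> real \<Rightarrow> bool" where
  "has_radius_of_convergence C r \<longleftrightarrow>
     (\<exists>M. geometric_growth_constant C M \<and> (\<forall>M'. geometric_growth_constant C M' \<longrightarrow> M \<le> M') \<and>
          r = 1 / (M * (real CARD('m) + 1)))"

end

theory Submission
  imports Defs
begin

text \<open>
  The left derivatives \<open>a (x # \<cdot>)\<close> act on shuffle products as derivations, and for \<open>y = c\<^sup>-\<^sup>1\<close> the equation
  \<open>y = - (c \<circ> y)\<close> (modified composition) turns into a differential equation for the left derivatives of
  \<open>c \<circ> y\<close>. If \<open>\<bar>(c, \<eta>)\<bar> \<le> K M ^ \<bar>\<eta>\<bar>\<close>, the exponential generating function of the resulting bounds, divided by
  \<open>K\<close>, solves \<open>F' = M F (1 + m K F)\<close>, \<open>F 0 = 1\<close>, so \<open>F z = 1 / ((1 + m K) exp (- M z) - m K)\<close>, whose nearest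
  singularity is a simple pole at \<open>ln (1 + 1 / (m K)) / M\<close>. Its coefficients are multiples of
  \<open>\<Sum>k. k ^ n * q ^ k\<close> with \<open>q = m K / (1 + m K)\<close> and are estimated from both sides by Gamma integrals.
  For \<open>(c\<^sub>i, \<eta>) = - K M ^ \<bar>\<eta>\<bar>\<close> all bounds are equalities along the words \<open>x\<^sub>0 \<dots> x\<^sub>0\<close>.
\<close>

section \<open>Shuffle product\<close>

lemma count_image_mset_Cons:
  "count (image_mset ((#) x) A) (y # \<nu>) = (if x = y then count A \<nu> else 0)"
  by (induction A) auto

lemma shuffle_words_Nil_left: "shuffle_words [] \<xi> = {#\<xi>#}"
  by (cases \<xi>) auto

lemma count_shuffle_words_Cons:
  "count (shuffle_words \<eta> \<xi>) (x # \<nu>) =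
     (case \<eta> of [] \<Rightarrow> 0 | y # \<eta>' \<Rightarrow> if y = x then count (shuffle_words \<eta>' \<xi>) \<nu> else 0) +
     (case \<xi> of [] \<Rightarrow> 0 | y # \<xi>' \<Rightarrow> if y = x then count (shuffle_words \<eta> \<xi>') \<nu> else 0)"
  by (cases \<eta>; cases \<xi>)
    (auto simp: count_image_mset_Cons shuffle_words_Nil_left)

lemma shuffle_Nil: "shuffle a b [] = a [] * b []"
proof -
  have "{(\<eta> :: 'a word, \<xi> :: 'a word). length \<eta> + length \<xi> = length ([] :: 'a word)} = {([], [])}"
    by auto
  then show ?thesis
    unfolding shuffle_def by simp
qed

text \<open>Each word of a shuffle starts with the first letter of one of the two factors, hence the
  Leibniz rule. Together with \<open>shuffle_Nil\<close> it determines the product, so the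
  identities below follow by induction on the word with the series left arbitrary.\<close>

lemma shuffle_Cons:
  "shuffle a b (x # \<nu>) = shuffle (\<lambda>\<eta>. a (x # \<eta>)) b \<nu> + shuffle a (\<lambda>\<eta>. b (x # \<eta>)) \<nu>"
proof -
  let ?P = "\<lambda>n. {(\<eta> :: 'a word, \<xi> :: 'a word). length \<eta> + length \<xi> = n}"
  let ?l = "\<lambda>(\<eta>, \<xi>). a \<eta> * b \<xi> *
    real (case \<eta> of [] \<Rightarrow> 0 | y # \<eta>' \<Rightarrow> if y = x then count (shuffle_words \<eta>' \<xi>) \<nu> else 0)"
  let ?r = "\<lambda>(\<eta>, \<xi>). a \<eta> * b \<xi> *
    real (case \<xi> of [] \<Rightarrow> 0 | y # \<xi>' \<Rightarrow> if y = x then count (shuffle_words \<eta> \<xi>') \<nu> else 0)"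
  let ?n = "length \<nu>"
  have fin: "finite (?P n)" for n
    by (rule finite_shuffle_support)
  have "shuffle a b (x # \<nu>) = (\<Sum>p\<in>?P (Suc ?n). ?l p + ?r p)"
    unfolding shuffle_def
    by (intro sum.cong) (auto simp: count_shuffle_words_Cons algebra_simps)
  also have "\<dots> = sum ?l (?P (Suc ?n)) + sum ?r (?P (Suc ?n))"
    by (rule sum.distrib)
  \<comment> \<open>Only words \<eta> starting with \<open>x\<close> contribute to
    \<open>?l\<close>; removing this letter gives pairs of total length \<open>?n\<close>.\<close>
  also have "sum ?l (?P (Suc ?n)) = sum ?l ((\<lambda>(\<eta>, \<xi>). (x # \<eta>, \<xi>)) ` ?P ?n)"
    by (rule sum.mono_neutral_right[OF fin])
      (auto split: list.splits if_splits simp: image_iff, blast)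
  also have "\<dots> = shuffle (\<lambda>\<eta>. a (x # \<eta>)) b \<nu>"
    unfolding shuffle_def
    by (subst sum.reindex) (auto simp: inj_on_def intro!: sum.cong)
  also have "sum ?r (?P (Suc ?n)) = sum ?r ((\<lambda>(\<eta>, \<xi>). (\<eta>, x # \<xi>)) ` ?P ?n)"
    by (rule sum.mono_neutral_right[OF fin])
      (auto split: list.splits if_splits simp: image_iff, blast)
  also have "\<dots> = shuffle a (\<lambda>\<eta>. b (x # \<eta>)) \<nu>"
    unfolding shuffle_def
    by (subst sum.reindex) (auto simp: inj_on_def intro!: sum.cong)
  finally show ?thesis .
qed

lemma shuffle_add_left: "shuffle (\<lambda>\<eta>. a \<eta> + b \<eta>) c \<nu> = shuffle a c \<nu> + shuffle b c \<nu>"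
  by (induction \<nu> arbitrary: a b c) (simp_all add: shuffle_Nil shuffle_Cons algebra_simps)

lemma shuffle_commute: "shuffle a b \<nu> = shuffle b a \<nu>"
  by (induction \<nu> arbitrary: a b) (simp_all add: shuffle_Nil shuffle_Cons)

lemma shuffle_add_right: "shuffle c (\<lambda>\<eta>. a \<eta> + b \<eta>) \<nu> = shuffle c a \<nu> + shuffle c b \<nu>"
  by (simp add: shuffle_commute[of c] shuffle_add_left)

lemma shuffle_scale_right: "shuffle c (\<lambda>\<eta>. r * a \<eta>) \<nu> = r * shuffle c a \<nu>"
  by (induction \<nu> arbitrary: a c) (simp_all add: shuffle_Nil shuffle_Cons algebra_simps)

lemma shuffle_zero_right: "shuffle c (\<lambda>\<eta>. 0) \<nu> = 0"
  using shuffle_scale_right[of c 0 "\<lambda>\<eta>. 0"] by simp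

lemma shuffle_zero_left: "shuffle (\<lambda>\<eta>. 0) c \<nu> = 0"
  using shuffle_zero_right[of c] by (simp add: shuffle_commute)

lemma shuffle_sum_right:
  "shuffle c (\<lambda>\<eta>. \<Sum>i\<in>I. a i \<eta>) \<nu> = (\<Sum>i\<in>I. shuffle c (a i) \<nu>)"
  by (induction I rule: infinite_finite_induct) (simp_all add: shuffle_zero_right shuffle_add_right)

lemma shuffle_sum_left:
  "shuffle (\<lambda>\<eta>. \<Sum>i\<in>I. a i \<eta>) c \<nu> = (\<Sum>i\<in>I. shuffle (a i) c \<nu>)"
  by (simp add: shuffle_commute[of _ c] shuffle_sum_right)

lemma shuffle_assoc: "shuffle (shuffle a b) c \<nu> = shuffle a (shuffle b c) \<nu>"
  by (induction \<nu> arbitrary: a b c)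
    (simp_all add: shuffle_Nil shuffle_Cons shuffle_add_left shuffle_add_right)

lemma shuffle_cong:
  assumes "\<And>\<xi>. length \<xi> \<le> length \<nu> \<Longrightarrow> a \<xi> = a' \<xi>"
    and "\<And>\<xi>. length \<xi> \<le> length \<nu> \<Longrightarrow> b \<xi> = b' \<xi>"
  shows "shuffle a b \<nu> = shuffle a' b' \<nu>"
  unfolding shuffle_def by (intro sum.cong) (auto simp: assms)

section \<open>Modified composition product\<close>

text \<open>A component of the modified composition product depends only on that component of the left factor.\<close>

definition comp_apply :: "'m::finite vseries \<Rightarrow> 'm series \<Rightarrow> 'm series" where
  "comp_apply d a = (\<lambda>\<nu>. \<Sum>\<eta> | length \<eta> \<le> length \<nu>. phi d \<eta> one_series \<nu> * a \<eta>)"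

lemma mod_comp_nth: "mod_comp c d \<nu> $ i = comp_apply d (\<lambda>\<eta>. c \<eta> $ i) \<nu>"
  by (simp add: mod_comp_def comp_apply_def)

text \<open>The added words are longer than \<nu> and contribute zero. A common range for all short
  \<nu> allows the sum to be pulled out of a shuffle product.\<close>

lemma comp_apply_extend:
  assumes "length \<nu> \<le> n"
  shows "comp_apply d a \<nu> = (\<Sum>\<eta> | length \<eta> \<le> n. phi d \<eta> one_series \<nu> * a \<eta>)"
  unfolding comp_apply_def using assms
  by (intro sum.mono_neutral_left finite_words_length_le) (auto simp: phi_one_eq_0)

lemma comp_apply_Nil: "comp_apply d a [] = a []"
  by (simp add: comp_apply_def one_series_def)

lemma sum_words_Suc:
  fixes f :: "'m::finite word \<Rightarrow> real"
  shows "(\<Sum>\<eta> | length \<eta> \<le> Suc n. f \<eta>) = f [] + (\<Sum>z\<in>UNIV. \<Sum>\<eta> | length \<eta> \<le> n. f (z # \<eta>))"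
proof -
  have eq: "{\<eta> :: 'm word. length \<eta> \<le> Suc n} =
      insert [] ((\<lambda>(z, \<eta>). z # \<eta>) ` (UNIV \<times> {\<eta>. length \<eta> \<le> n}))"
    by (auto simp: image_iff) (metis Suc_le_mono length_Cons neq_Nil_conv)
  have "(\<Sum>\<eta> | length \<eta> \<le> Suc n. f \<eta>) =
      f [] + sum f ((\<lambda>(z, \<eta>). z # \<eta>) ` (UNIV \<times> {\<eta>. length \<eta> \<le> n}))"
    unfolding eq by (subst sum.insert) (auto simp: finite_words_length_le)
  also have "sum f ((\<lambda>(z, \<eta>). z # \<eta>) ` (UNIV \<times> {\<eta>. length \<eta> \<le> n})) =
      (\<Sum>z\<in>UNIV. \<Sum>\<eta> | length \<eta> \<le> n. f (z # \<eta>))"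
    by (subst sum.reindex) (auto simp: inj_on_def sum.cartesian_product intro!: sum.cong)
  finally show ?thesis .
qed

text \<open>\<open>phi d (z # \<eta>)\<close> puts in front either \<open>z\<close>, or
  \<open>x\<^sub>0\<close> followed by a shuffle with the component of \<open>d\<close> at
  \<open>z\<close>. So only the left derivative by \<open>x\<^sub>0\<close> sees \<open>d\<close>.
  This is the differential equation behind all later inductions.\<close>

lemma comp_apply_Cons:
  "comp_apply d a (x # \<nu>) = comp_apply d (\<lambda>\<eta>. a (x # \<eta>)) \<nu> +
     (if x = None then \<Sum>i\<in>UNIV. shuffle (\<lambda>\<eta>. d \<eta> $ i) (comp_apply d (\<lambda>\<eta>. a (Some i # \<eta>))) \<nu> else 0)"
proof -
  let ?W = "{\<eta> :: 'a word. length \<eta> \<le> length \<nu>}"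
  have shuffle_sum: "(\<Sum>\<eta>\<in>?W. shuffle b (phi d \<eta> one_series) \<nu> * e \<eta>) = shuffle b (comp_apply d e) \<nu>"
    for b e
  proof -
    have "shuffle b (comp_apply d e) \<nu> = shuffle b (\<lambda>\<xi>. \<Sum>\<eta>\<in>?W. e \<eta> * phi d \<eta> one_series \<xi>) \<nu>"
      by (rule shuffle_cong) (auto simp: comp_apply_extend[where n = "length \<nu>"] mult.commute)
    then show ?thesis
      by (simp add: shuffle_sum_right shuffle_scale_right mult.commute)
  qed
  have "comp_apply d a (x # \<nu>) = (\<Sum>z\<in>UNIV. \<Sum>\<eta>\<in>?W. phi d (z # \<eta>) one_series (x # \<nu>) * a (z # \<eta>))"
    unfolding comp_apply_def by (simp add: sum_words_Suc one_series_def del: phi.simps(2))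
  also have "\<dots> = (\<Sum>z\<in>UNIV. (if x = z then comp_apply d (\<lambda>\<eta>. a (z # \<eta>)) \<nu> else 0) +
      (if x = None then shuffle (component d z) (comp_apply d (\<lambda>\<eta>. a (z # \<eta>))) \<nu> else 0))"
    by (intro sum.cong refl)
      (auto simp: phi_letter_def letter_mult_def comp_apply_def[of d] ring_distribs
        sum.distrib shuffle_sum)
  also have "\<dots> = comp_apply d (\<lambda>\<eta>. a (x # \<eta>)) \<nu> +
      (if x = None then \<Sum>z\<in>UNIV. shuffle (component d z) (comp_apply d (\<lambda>\<eta>. a (z # \<eta>))) \<nu> else 0)"
    by (cases x) (simp_all add: sum.distrib)
  \<comment> \<open>The letter \<open>None\<close> drops out because its component is zero.\<close>
  also have "(\<Sum>z\<in>UNIV. shuffle (component d z) (comp_apply d (\<lambda>\<eta>. a (z # \<eta>))) \<nu>) =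
      (\<Sum>i\<in>UNIV. shuffle (\<lambda>\<eta>. d \<eta> $ i) (comp_apply d (\<lambda>\<eta>. a (Some i # \<eta>))) \<nu>)"
    by (simp add: UNIV_option_conv sum.reindex component_def shuffle_zero_left)
  finally show ?thesis .
qed

section \<open>Linearity and multiplicativity in the left factor\<close>

lemma comp_apply_add: "comp_apply d (\<lambda>\<eta>. a \<eta> + b \<eta>) \<nu> = comp_apply d a \<nu> + comp_apply d b \<nu>"
  by (simp add: comp_apply_def ring_distribs sum.distrib)

lemma comp_apply_scale: "comp_apply d (\<lambda>\<eta>. r * a \<eta>) \<nu> = r * comp_apply d a \<nu>"
  by (simp add: comp_apply_def sum_distrib_left mult_ac)

lemma comp_apply_sum:
  "comp_apply d (\<lambda>\<eta>. \<Sum>i\<in>I. a i \<eta>) \<nu> = (\<Sum>i\<in>I. comp_apply d (a i) \<nu>)"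
  unfolding comp_apply_def sum_distrib_left by (rule sum.swap)

text \<open>Both sides have the same left derivatives. The induction is on the length, since the
  term with \<open>d\<close> in \<open>comp_apply_Cons\<close> requires the claim for all words up
  to the length of the tail.\<close>

lemma comp_apply_shuffle:
  "comp_apply d (shuffle a b) \<nu> = shuffle (comp_apply d a) (comp_apply d b) \<nu>"
proof (induction "length \<nu>" arbitrary: a b \<nu> rule: less_induct)
  case less
  show ?case
  proof (cases \<nu>)
    case Nil
    then show ?thesis
      by (simp add: comp_apply_Nil shuffle_Nil)
  next
    case (Cons x \<mu>)
    have IH: "comp_apply d (shuffle a b) \<xi> = shuffle (comp_apply d a) (comp_apply d b) \<xi>"
      if "length \<xi> \<le> length \<mu>" for a b \<xi>
      using less.hyps[of \<xi>] that Cons by simp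
    have inner: "shuffle e (comp_apply d (shuffle a b)) \<mu> =
        shuffle e (shuffle (comp_apply d a) (comp_apply d b)) \<mu>" for e a b
      by (rule shuffle_cong) (auto simp: IH)
    \<comment> \<open>Deriving the second factor by \<open>x\<^sub>0\<close> places a component of
      \<open>d\<close> inside it; this moves the component to the front.\<close>
    have left_comm: "shuffle u (shuffle v w) \<mu> = shuffle v (shuffle u w) \<mu>" for u v w :: "'a series"
    proof -
      have "shuffle u v = shuffle v u"
        by (rule ext) (rule shuffle_commute)
      then show ?thesis
        by (metis shuffle_assoc)
    qed
    have add: "comp_apply d (\<lambda>\<eta>. a \<eta> + b \<eta>) = (\<lambda>\<eta>. comp_apply d a \<eta> + comp_apply d b \<eta>)" for a b
      by (rule ext) (rule comp_apply_add)
    show ?thesis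
      unfolding Cons
      by (cases x) (simp_all add: comp_apply_Cons shuffle_Cons add shuffle_add_left shuffle_add_right
          IH inner shuffle_sum_left shuffle_sum_right sum.distrib shuffle_assoc left_comm[of "comp_apply d a"])
  qed
qed

text \<open>Deriving by \<open>x\<^sub>0\<close> on the left yields one shuffle with a component of
  \<open>e\<close> and, by \<open>comp_apply_shuffle\<close>, one with a component of
  \<open>mod_comp d e\<close>; they add up to the group product. Associativity follows.\<close>

lemma comp_apply_comp:
  "comp_apply e (comp_apply d a) \<nu> = comp_apply (\<lambda>\<eta>. e \<eta> + mod_comp d e \<eta>) a \<nu>"
proof (induction "length \<nu>" arbitrary: a \<nu> rule: less_induct)
  case less
  let ?f = "\<lambda>\<eta>. e \<eta> + mod_comp d e \<eta>"
  show ?case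
  proof (cases \<nu>)
    case Nil
    then show ?thesis
      by (simp add: comp_apply_Nil)
  next
    case (Cons x \<mu>)
    have IH: "comp_apply e (comp_apply d a) \<xi> = comp_apply ?f a \<xi>"
      if "length \<xi> \<le> length \<mu>" for a \<xi>
      using less.hyps[of \<xi>] that Cons by simp
    have inner: "shuffle b (comp_apply e (comp_apply d a)) \<mu> = shuffle b (comp_apply ?f a) \<mu>" for a b
      by (rule shuffle_cong) (auto simp: IH)
    show ?thesis
      unfolding Cons
      by (cases x) (simp_all add: comp_apply_Cons comp_apply_add comp_apply_sum comp_apply_shuffle
          shuffle_add_left mod_comp_nth sum.distrib IH inner)
  qed
qed

lemma comp_apply_zero_left: "comp_apply (\<lambda>\<eta>. 0) a \<nu> = a \<nu>"
  by (induction \<nu> arbitrary: a) (simp_all add: comp_apply_Nil comp_apply_Cons shuffle_zero_left)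

section \<open>The monoid of formal elements\<close>

lemma monoid_delta_group: "monoid (delta_group :: 'm::finite vseries monoid)"
proof
  fix c d e :: "'m vseries"
  show "c \<otimes>\<^bsub>delta_group\<^esub> d \<otimes>\<^bsub>delta_group\<^esub> e = c \<otimes>\<^bsub>delta_group\<^esub> (d \<otimes>\<^bsub>delta_group\<^esub> e)"
    by (auto simp: delta_group_def fun_eq_iff vec_eq_iff mod_comp_nth comp_apply_add
        comp_apply_comp[symmetric])
  show "\<one>\<^bsub>delta_group\<^esub> \<otimes>\<^bsub>delta_group\<^esub> c = c"
    by (simp add: delta_group_def mod_comp_def)
  show "c \<otimes>\<^bsub>delta_group\<^esub> \<one>\<^bsub>delta_group\<^esub> = c"
    by (simp add: delta_group_def fun_eq_iff vec_eq_iff mod_comp_nth comp_apply_zero_left)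
qed (simp_all add: delta_group_def)

section \<open>Existence of the composition inverse\<close>

text \<open>By \<open>comp_apply_Cons\<close>, \<open>d\<close> enters only after a letter has been
  removed. The map \<open>d \<mapsto> mod_comp c d\<close> is therefore a contraction in the
  ultrametric sense.\<close>

lemma comp_apply_cong_left:
  assumes "\<And>\<xi>. length \<xi> < length \<nu> \<Longrightarrow> d \<xi> = d' \<xi>"
  shows "comp_apply d a \<nu> = comp_apply d' a \<nu>"
  using assms
proof (induction "length \<nu>" arbitrary: a \<nu> rule: less_induct)
  case less
  show ?case
  proof (cases \<nu>)
    case Nil
    then show ?thesis
      by (simp add: comp_apply_Nil)
  next
    case (Cons x \<mu>)
    have IH: "comp_apply d a \<xi> = comp_apply d' a \<xi>" if "length \<xi> \<le> length \<mu>" for a \<xi>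
      using less.hyps[of \<xi>] less.prems that Cons by simp
    have inner: "shuffle (\<lambda>\<eta>. d \<eta> $ i) (comp_apply d a) \<mu> = shuffle (\<lambda>\<eta>. d' \<eta> $ i) (comp_apply d' a) \<mu>"
      for a i
      using less.prems Cons by (intro shuffle_cong) (auto simp: IH)
    show ?thesis
      unfolding Cons by (simp add: comp_apply_Cons IH inner)
  qed
qed

lemma mod_comp_cong_right:
  assumes "\<And>\<xi>. length \<xi> < length \<nu> \<Longrightarrow> d \<xi> = d' \<xi>"
  shows "mod_comp c d \<nu> = mod_comp c d' \<nu>"
  by (simp add: vec_eq_iff mod_comp_nth comp_apply_cong_left[of \<nu> d d'] assms)

text \<open>Fixed-point iteration for \<open>y = - mod_comp c y\<close>; the iterate with index
  \<open>n\<close> is final on words shorter than \<open>n\<close>.\<close>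

primrec inverse_approx :: "'m::finite vseries \<Rightarrow> nat \<Rightarrow> 'm vseries" where
  "inverse_approx c 0 = (\<lambda>\<nu>. 0)"
| "inverse_approx c (Suc n) = (\<lambda>\<nu>. - mod_comp c (inverse_approx c n) \<nu>)"

lemma inverse_approx_Suc_eq:
  "length \<nu> < n \<Longrightarrow> inverse_approx c (Suc n) \<nu> = inverse_approx c n \<nu>"
proof (induction n arbitrary: \<nu>)
  case (Suc n)
  then have "mod_comp c (inverse_approx c (Suc n)) \<nu> = mod_comp c (inverse_approx c n) \<nu>"
    by (intro mod_comp_cong_right) simp
  then show ?case
    by simp
qed simp

lemma inverse_approx_eq:
  assumes "length \<nu> < n" "n \<le> k"
  shows "inverse_approx c k \<nu> = inverse_approx c n \<nu>"
  using assms(2,1)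
  by (induction k rule: dec_induct) (simp_all add: inverse_approx_Suc_eq del: inverse_approx.simps)

lemma right_inverse_exists: "\<exists>y. \<forall>\<nu>. y \<nu> = - mod_comp c y \<nu>"
proof (intro exI allI)
  fix \<nu> :: "'a word"
  \<comment> \<open>The limit: each coefficient is read off the first iterate that is final
    there.\<close>
  let ?y = "\<lambda>\<nu>. inverse_approx c (Suc (length \<nu>)) \<nu>"
  have "mod_comp c ?y \<nu> = mod_comp c (inverse_approx c (length \<nu>)) \<nu>"
    by (rule mod_comp_cong_right) (rule inverse_approx_eq[symmetric], auto)
  then show "?y \<nu> = - mod_comp c ?y \<nu>"
    by simp
qed

lemma comp_inverse_eq: "comp_inverse c \<nu> = - mod_comp c (comp_inverse c) \<nu>"
proof -
  let ?G = "delta_group :: 'a vseries monoid"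
  interpret monoid ?G
    by (rule monoid_delta_group)
  have carrier: "x \<in> carrier ?G" for x
    by (simp add: delta_group_def)
  have right: "\<exists>y. x \<otimes>\<^bsub>?G\<^esub> y = \<one>\<^bsub>?G\<^esub> \<and> (\<forall>\<nu>. y \<nu> = - mod_comp x y \<nu>)" for x
  proof -
    obtain y where y: "\<forall>\<nu>. y \<nu> = - mod_comp x y \<nu>"
      using right_inverse_exists by blast
    then have "\<forall>\<nu>. y \<nu> + mod_comp x y \<nu> = 0"
      by (metis add.left_inverse)
    then have "x \<otimes>\<^bsub>?G\<^esub> y = \<one>\<^bsub>?G\<^esub>"
      by (simp add: delta_group_def)
    with y show ?thesis
      by blast
  qed
  obtain y where y: "c \<otimes>\<^bsub>?G\<^esub> y = \<one>\<^bsub>?G\<^esub>" "\<forall>\<nu>. y \<nu> = - mod_comp c y \<nu>"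
    using right by blast
  obtain z where z: "y \<otimes>\<^bsub>?G\<^esub> z = \<one>\<^bsub>?G\<^esub>"
    using right by blast
  \<comment> \<open>A right inverse \<open>y\<close> of \<open>c\<close> that has a right inverse
    \<open>z\<close> itself is two-sided, because \<open>c = c (y z) = (c y) z = z\<close>.\<close>
  have "c = z"
    using carrier y(1) z by (metis m_assoc l_one r_one)
  then have "y = comp_inverse c"
    unfolding comp_inverse_def using y(1) z carrier by (intro inv_unique') auto
  then show ?thesis
    using y(2) by blast
qed

section \<open>Binomial convolution\<close>

text \<open>The product of exponential generating functions, on the level of their coefficients
  times \<open>n!\<close>.\<close>

definition binomial_conv :: "(nat \<Rightarrow> real) \<Rightarrow> (nat \<Rightarrow> real) \<Rightarrow> nat \<Rightarrow> real" where
  "binomial_conv A B n = (\<Sum>k\<le>n. real (n choose k) * A k * B (n - k))"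

lemma binomial_conv_Suc:
  "binomial_conv A B (Suc n) =
     binomial_conv (\<lambda>k. A (Suc k)) B n + binomial_conv A (\<lambda>k. B (Suc k)) n"
proof -
  have "binomial_conv A (\<lambda>k. B (Suc k)) n = (\<Sum>k\<le>n. real (n choose k) * A k * B (Suc n - k))"
    unfolding binomial_conv_def by (intro sum.cong) (auto simp: Suc_diff_le)
  also have "\<dots> = (\<Sum>k\<le>Suc n. real (n choose k) * A k * B (Suc n - k))"
    by simp
  also have "\<dots> = A 0 * B (Suc n) + (\<Sum>k\<le>n. real (n choose Suc k) * A (Suc k) * B (n - k))"
    by (subst sum.atMost_Suc_shift) simp
  moreover have "binomial_conv A B (Suc n) =
      A 0 * B (Suc n) + (\<Sum>k\<le>n. real (Suc n choose Suc k) * A (Suc k) * B (n - k))"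
    unfolding binomial_conv_def by (subst sum.atMost_Suc_shift) simp
  ultimately show ?thesis
    by (simp add: binomial_conv_def ring_distribs sum.distrib)
qed

lemma binomial_conv_scale:
  "binomial_conv (\<lambda>k. r * A k) (\<lambda>k. s * B k) n = r * s * binomial_conv A B n"
  by (simp add: binomial_conv_def sum_distrib_left mult_ac)

text \<open>\<open>shuffle_Cons\<close> and \<open>binomial_conv_Suc\<close> are the same Leibniz
  rule, so bounds that depend only on the length pass through each derivative as shifted
  sequences.\<close>

lemma shuffle_abs_le:
  assumes "\<And>\<xi>. length \<xi> \<le> length \<nu> \<Longrightarrow> \<bar>a \<xi>\<bar> \<le> A (length \<xi>)"
    and "\<And>\<xi>. length \<xi> \<le> length \<nu> \<Longrightarrow> \<bar>b \<xi>\<bar> \<le> B (length \<xi>)"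
  shows "\<bar>shuffle a b \<nu>\<bar> \<le> binomial_conv A B (length \<nu>)"
  using assms
proof (induction \<nu> arbitrary: a b A B)
  case Nil
  from Nil(1)[of "[]"] Nil(2)[of "[]"] have "\<bar>a []\<bar> * \<bar>b []\<bar> \<le> A 0 * B 0"
    by (intro mult_mono) auto
  then show ?case
    by (simp add: shuffle_Nil binomial_conv_def abs_mult)
next
  case (Cons x \<nu>)
  have a: "\<bar>a \<xi>\<bar> \<le> A (length \<xi>)" and b: "\<bar>b \<xi>\<bar> \<le> B (length \<xi>)" if "length \<xi> \<le> Suc (length \<nu>)" for \<xi>
    using Cons.prems that by auto
  have "\<bar>shuffle (\<lambda>\<eta>. a (x # \<eta>)) b \<nu>\<bar> \<le> binomial_conv (\<lambda>k. A (Suc k)) B (length \<nu>)"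
    using a[of "x # _"] b by (intro Cons.IH) auto
  moreover have "\<bar>shuffle a (\<lambda>\<eta>. b (x # \<eta>)) \<nu>\<bar> \<le> binomial_conv A (\<lambda>k. B (Suc k)) (length \<nu>)"
    using a b[of "x # _"] by (intro Cons.IH) auto
  ultimately show ?case
    by (simp add: shuffle_Cons binomial_conv_Suc)
qed

text \<open>Along powers of one letter the estimate \<open>shuffle_abs_le\<close> becomes an
  identity; sharpness rests on this.\<close>

lemma shuffle_replicate:
  "shuffle a b (replicate n x) =
     binomial_conv (\<lambda>k. a (replicate k x)) (\<lambda>k. b (replicate k x)) n"
  by (induction n arbitrary: a b) (simp_all add: shuffle_Nil shuffle_Cons binomial_conv_Suc,
    simp add: binomial_conv_def)

section \<open>The power moments of a geometric sequence\<close>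

text \<open>For \<open>0 < q < 1\<close>, the exponential generating function is
  \<open>P z = q exp z / (1 - q exp z)\<close>, which satisfies \<open>P' = P + P\<^sup>2\<close>.
  Starting at 1 excludes the term \<open>0 ^ 0\<close> at \<open>n = 0\<close>.\<close>

definition geometric_moment :: "real \<Rightarrow> nat \<Rightarrow> real" where
  "geometric_moment q n = (\<Sum>k. real (Suc k) ^ n * q ^ Suc k)"

text \<open>This is \<open>\<integral>\<^sub>x\<^sup>\<infinity> u\<^sup>n exp (- t u) du\<close>, which is compared with \<open>\<Sum>k. k ^ n * exp (- t) ^ k\<close>.\<close>

definition gamma_tail :: "real \<Rightarrow> nat \<Rightarrow> real \<Rightarrow> real" where
  "gamma_tail t n x = fact n / t ^ Suc n * (exp (- (t * x)) * (\<Sum>j\<le>n. (t * x) ^ j / fact j))"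

lemma gamma_tail_0: "gamma_tail t n 0 = fact n / t ^ Suc n"
proof -
  have "(\<Sum>j\<le>n. (0::real) ^ j / fact j) = 1"
    by (induction n) auto
  then show ?thesis
    by (simp add: gamma_tail_def)
qed

lemma gamma_tail_has_derivative:
  assumes "t > 0"
  shows "(gamma_tail t n has_real_derivative - (x ^ n * exp (- (t * x)))) (at x)"
proof -
  \<comment> \<open>Differentiating a truncated exponential series loses its top term, so after
    multiplication by \<open>exp (- (t * x))\<close> a single monomial survives.\<close>
  have poly: "((\<lambda>x. \<Sum>j\<le>n. (t * x) ^ j / fact j) has_real_derivative
      t * ((\<Sum>j\<le>n. (t * x) ^ j / fact j) - (t * x) ^ n / fact n)) (at x)" for n
  proof (induction n)
    case (Suc n)
    have "((\<lambda>x. (t * x) ^ Suc n / fact (Suc n)) has_real_derivative t * ((t * x) ^ n / fact n)) (at x)"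
      by (rule derivative_eq_intros refl | simp add: field_simps del: of_nat_Suc)+
    from DERIV_add[OF Suc this] show ?case
      by (simp add: algebra_simps)
  qed (simp add: field_simps)
  show ?thesis
    unfolding gamma_tail_def
    by (rule derivative_eq_intros poly refl)+
      (use assms in \<open>simp add: algebra_simps power_mult_distrib\<close>)
qed

lemma gamma_tail_LIMSEQ:
  assumes "t > 0"
  shows "(\<lambda>k. gamma_tail t n (real k)) \<longlonglongrightarrow> 0"
proof -
  have at_top: "filterlim (\<lambda>k. t * real k) at_top sequentially"
    using assms by (intro filterlim_tendsto_pos_mult_at_top[OF tendsto_const] filterlim_real_sequentially)
  have "(\<lambda>k. fact n / t ^ Suc n * (\<Sum>j\<le>n. (t * real k) ^ j / exp (t * real k) / fact j))
      \<longlonglongrightarrow> fact n / t ^ Suc n * (\<Sum>j\<le>n. 0 / fact j)"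
    by (intro tendsto_intros filterlim_compose[OF tendsto_power_div_exp_0 at_top]) auto
  then show ?thesis
    by (simp add: gamma_tail_def exp_minus sum_distrib_left field_simps)
qed

text \<open>The integrand \<open>u ^ n * exp (- (t * u))\<close> need not be monotone on the
  interval, so its two factors are bounded separately, at opposite endpoints.\<close>

lemma gamma_tail_diff_bounds:
  assumes "t > 0"
  shows "real k ^ n * exp (- (t * real (Suc k))) \<le> gamma_tail t n (real k) - gamma_tail t n (real (Suc k))"
    and "gamma_tail t n (real k) - gamma_tail t n (real (Suc k)) \<le> real (Suc k) ^ n * exp (- (t * real k))"
proof -
  have "real k < real (Suc k)"
    by simp
  from MVT2[OF this gamma_tail_has_derivative[OF assms]]
  obtain z where z: "real k < z" "z < real (Suc k)"
    and "gamma_tail t n (real (Suc k)) - gamma_tail t n (real k) =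
      (real (Suc k) - real k) * - (z ^ n * exp (- (t * z)))"
    by blast
  then have eq: "gamma_tail t n (real k) - gamma_tail t n (real (Suc k)) = z ^ n * exp (- (t * z))"
    by simp
  have "0 \<le> z"
    using z by linarith
  show "real k ^ n * exp (- (t * real (Suc k))) \<le> gamma_tail t n (real k) - gamma_tail t n (real (Suc k))"
    unfolding eq using z assms by (intro mult_mono power_mono) auto
  show "gamma_tail t n (real k) - gamma_tail t n (real (Suc k)) \<le> real (Suc k) ^ n * exp (- (t * real k))"
    unfolding eq using z assms \<open>0 \<le> z\<close> by (intro mult_mono power_mono) auto
qed

context
  fixes t q :: real
  assumes t: "t > 0" and q: "q = exp (- t)"
begin

lemma gamma_tail_diff_sums:
  "(\<lambda>k. gamma_tail t n (real k) - gamma_tail t n (real (Suc k))) sums (fact n / t ^ Suc n)"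
  using telescope_sums'[OF gamma_tail_LIMSEQ[OF t, of n]] by (simp add: gamma_tail_0)

lemma gamma_tail_diff_sums_Suc:
  "(\<lambda>k. gamma_tail t n (real (Suc k)) - gamma_tail t n (real (Suc (Suc k)))) sums gamma_tail t n 1"
  using telescope_sums'[OF LIMSEQ_Suc[OF gamma_tail_LIMSEQ[OF t, of n]]] by simp

lemma q_power: "q ^ k = exp (- (t * real k))"
  by (simp add: q exp_of_nat_mult[symmetric] mult.commute)

text \<open>Comparison with the interval to the right of \<open>Suc k\<close>; the mismatch of
  endpoints costs the factor \<open>exp t\<close>. The lower bound below uses the interval to the
  left.\<close>

lemma moment_term_le:
  "real (Suc k) ^ n * q ^ Suc k \<le>
     exp t * (gamma_tail t n (real (Suc k)) - gamma_tail t n (real (Suc (Suc k))))"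
proof -
  have "q ^ Suc k = exp t * exp (- (t * real (Suc (Suc k))))"
    unfolding q_power mult_exp_exp by (simp add: algebra_simps)
  then have "real (Suc k) ^ n * q ^ Suc k =
      exp t * (real (Suc k) ^ n * exp (- (t * real (Suc (Suc k)))))"
    by (simp only: mult.left_commute)
  also have "\<dots> \<le> exp t * (gamma_tail t n (real (Suc k)) - gamma_tail t n (real (Suc (Suc k))))"
    by (intro mult_left_mono gamma_tail_diff_bounds t exp_ge_zero)
  finally show ?thesis .
qed

lemma moment_term_ge:
  "exp (- t) * (gamma_tail t n (real k) - gamma_tail t n (real (Suc k))) \<le>
     real (Suc k) ^ n * q ^ Suc k"
proof -
  have "q ^ Suc k = exp (- t) * exp (- (t * real k))"
    unfolding q_power mult_exp_exp by (simp add: algebra_simps)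
  then have eq: "real (Suc k) ^ n * q ^ Suc k = exp (- t) * (real (Suc k) ^ n * exp (- (t * real k)))"
    by (simp only: mult.left_commute)
  show ?thesis
    unfolding eq by (intro mult_left_mono gamma_tail_diff_bounds t exp_ge_zero)
qed

lemma geometric_moment_sums: "(\<lambda>k. real (Suc k) ^ n * q ^ Suc k) sums geometric_moment q n"
  unfolding geometric_moment_def
proof (rule summable_sums, rule summable_comparison_test')
  show "summable (\<lambda>k. exp t * (gamma_tail t n (real (Suc k)) - gamma_tail t n (real (Suc (Suc k)))))"
    by (intro summable_mult sums_summable[OF gamma_tail_diff_sums_Suc])
  show "norm (real (Suc k) ^ n * q ^ Suc k) \<le>
      exp t * (gamma_tail t n (real (Suc k)) - gamma_tail t n (real (Suc (Suc k))))" if "k \<ge> 0" for k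
    using moment_term_le[of k n] q by (simp del: of_nat_Suc power_Suc)
qed

lemma geometric_moment_le: "geometric_moment q n \<le> exp t * (fact n / t ^ Suc n)"
proof -
  have "geometric_moment q n \<le> exp t * gamma_tail t n 1"
    using sums_le[OF moment_term_le geometric_moment_sums sums_mult[OF gamma_tail_diff_sums_Suc]] .
  also have "0 \<le> gamma_tail t n (real 0) - gamma_tail t n (real (Suc 0))"
    by (rule order_trans[OF _ gamma_tail_diff_bounds(1)[OF t]]) simp
  then have "exp t * gamma_tail t n 1 \<le> exp t * (fact n / t ^ Suc n)"
    by (intro mult_left_mono) (simp_all add: gamma_tail_0)
  finally show ?thesis .
qed

lemma geometric_moment_ge: "exp (- t) * (fact n / t ^ Suc n) \<le> geometric_moment q n"
  using sums_le[OF moment_term_ge sums_mult[OF gamma_tail_diff_sums] geometric_moment_sums] .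

text \<open>The coefficient form of \<open>P' = P + P\<^sup>2\<close>. In the Cauchy products, the
  binomial theorem turns each pair of indices into \<open>(k + 2) ^ n * q ^ (k + 2)\<close>; there
  are \<open>k + 1 = (k + 2) - 1\<close> pairs, which gives a difference of consecutive
  moments.\<close>

lemma geometric_moment_Suc:
  "geometric_moment q (Suc n) =
     geometric_moment q n + binomial_conv (geometric_moment q) (geometric_moment q) n"
proof -
  let ?u = "\<lambda>j k. real (Suc k) ^ j * q ^ Suc k"
  have norm_u: "norm (?u j k) = ?u j k" for j k
    using q by (simp del: of_nat_Suc power_Suc)
  have "(\<lambda>k. \<Sum>i\<le>k. ?u j i * ?u l (k - i)) sums (geometric_moment q j * geometric_moment q l)" for j l
    unfolding geometric_moment_def
    by (rule Cauchy_product_sums; unfold norm_u)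
      (rule sums_summable[OF geometric_moment_sums])+
  then have "(\<lambda>k. \<Sum>j\<le>n. real (n choose j) * (\<Sum>i\<le>k. ?u j i * ?u (n - j) (k - i))) sums
      (\<Sum>j\<le>n. real (n choose j) * (geometric_moment q j * geometric_moment q (n - j)))"
    by (intro sums_sum sums_mult)
  also have "(\<Sum>j\<le>n. real (n choose j) * (geometric_moment q j * geometric_moment q (n - j))) =
      binomial_conv (geometric_moment q) (geometric_moment q) n"
    by (simp add: binomial_conv_def mult.assoc)
  also have "(\<lambda>k. \<Sum>j\<le>n. real (n choose j) * (\<Sum>i\<le>k. ?u j i * ?u (n - j) (k - i))) =
      (\<lambda>k. real (Suc k) * ?u n (Suc k))"
  proof
    fix k
    have "(\<Sum>j\<le>n. real (n choose j) * (?u j i * ?u (n - j) (k - i))) = ?u n (Suc k)" if "i \<le> k" for i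
    proof -
      have "q ^ Suc i * q ^ Suc (k - i) = q ^ Suc (Suc k)"
        using that by (simp add: power_add[symmetric])
      then have "(\<Sum>j\<le>n. real (n choose j) * (?u j i * ?u (n - j) (k - i))) =
          (\<Sum>j\<le>n. real (n choose j) * real (Suc i) ^ j * real (Suc (k - i)) ^ (n - j)) * q ^ Suc (Suc k)"
        unfolding sum_distrib_right by (intro sum.cong) (simp_all add: mult_ac del: of_nat_Suc power_Suc)
      also have "\<dots> = (real (Suc i) + real (Suc (k - i))) ^ n * q ^ Suc (Suc k)"
        by (subst binomial_ring) simp
      also have "real (Suc i) + real (Suc (k - i)) = real (Suc (Suc k))"
        using that by simp
      finally show ?thesis .
    qed
    then have "(\<Sum>i\<le>k. \<Sum>j\<le>n. real (n choose j) * (?u j i * ?u (n - j) (k - i))) =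
        real (Suc k) * ?u n (Suc k)"
      by simp
    then show "(\<Sum>j\<le>n. real (n choose j) * (\<Sum>i\<le>k. ?u j i * ?u (n - j) (k - i))) =
        real (Suc k) * ?u n (Suc k)"
      unfolding sum_distrib_left by (subst sum.swap)
  qed
  \<comment> \<open>The index shift is free because the term at \<open>k = 0\<close>
    vanishes.\<close>
  finally have "(\<lambda>k. real k * ?u n k) sums binomial_conv (geometric_moment q) (geometric_moment q) n"
    by (subst (asm) sums_Suc_iff[where f = "\<lambda>k. real k * ?u n k"]) simp
  moreover have "(\<lambda>k. ?u (Suc n) k - ?u n k) sums (geometric_moment q (Suc n) - geometric_moment q n)"
    by (intro sums_diff geometric_moment_sums)
  then have "(\<lambda>k. real k * ?u n k) sums (geometric_moment q (Suc n) - geometric_moment q n)"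
    by (simp add: algebra_simps)
  ultimately show ?thesis
    using sums_unique2 by fastforce
qed

end

section \<open>The majorant\<close>

text \<open>
  The Taylor coefficients, multiplied by \<open>n!\<close>, of the solution \<open>1 / ((1 + r) exp (- M z) - r)\<close> of
  \<open>F' = M F (1 + r F)\<close>, \<open>F 0 = 1\<close>, expanded as a geometric series in \<open>r / (1 + r) * exp (M z)\<close>.
\<close>

definition majorant :: "real \<Rightarrow> real \<Rightarrow> nat \<Rightarrow> real" where
  "majorant r M n = M ^ n / r * geometric_moment (r / (1 + r)) n"

lemma exp_minus_ln_ratio:
  fixes r :: real
  assumes "r > 0"
  shows "ln (1 + 1 / r) > 0" and "r / (1 + r) = exp (- ln (1 + 1 / r))"
proof -
  show "ln (1 + 1 / r) > 0"
    using assms by (simp add: add_pos_pos)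
  have "1 + 1 / r > 0"
    using assms by (simp add: add_pos_pos)
  then have "exp (- ln (1 + 1 / r)) = inverse (1 + 1 / r)"
    by (simp add: exp_minus)
  also have "\<dots> = r / (1 + r)"
    using assms by (simp add: field_simps)
  finally show "r / (1 + r) = exp (- ln (1 + 1 / r))" ..
qed

lemma majorant_0:
  assumes "r > 0"
  shows "majorant r M 0 = 1"
proof -
  let ?q = "r / (1 + r)"
  have "norm ?q < 1"
    using assms by simp
  then have "(\<lambda>k. ?q * ?q ^ k) sums (?q * (1 / (1 - ?q)))"
    by (intro sums_mult geometric_sums)
  moreover have "(\<lambda>k. ?q * ?q ^ k) sums geometric_moment ?q 0"
    using geometric_moment_sums[OF exp_minus_ln_ratio[OF assms], of 0] by simp
  ultimately have "geometric_moment ?q 0 = ?q * (1 / (1 - ?q))"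
    by (rule sums_unique2[symmetric])
  also have "\<dots> = r"
    using assms by (simp add: field_simps)
  finally show ?thesis
    using assms by (simp add: majorant_def)
qed

lemma majorant_Suc:
  assumes "r > 0"
  shows "majorant r M (Suc n) =
    M * majorant r M n + r * M * binomial_conv (majorant r M) (majorant r M) n"
proof -
  let ?S = "geometric_moment (r / (1 + r))"
  have "binomial_conv (majorant r M) (majorant r M) n = M ^ n / r\<^sup>2 * binomial_conv ?S ?S n"
    unfolding binomial_conv_def sum_distrib_left majorant_def
  proof (rule sum.cong)
    fix k assume "k \<in> {..n}"
    then have eq: "M ^ n = M ^ k * M ^ (n - k)"
      by (simp add: power_add[symmetric])
    show "real (n choose k) * (M ^ k / r * ?S k) * (M ^ (n - k) / r * ?S (n - k)) =
        M ^ n / r\<^sup>2 * (real (n choose k) * ?S k * ?S (n - k))"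
      unfolding eq by (simp add: power2_eq_square mult_ac)
  qed simp
  then show ?thesis
    using assms geometric_moment_Suc[OF exp_minus_ln_ratio[OF assms], of n]
    by (simp add: majorant_def field_simps power2_eq_square)
qed

text \<open>Both bounds have the rate \<open>M / t\<close>, the reciprocal of the distance to the
  pole; their constants differ by \<open>exp (2 * t)\<close>.\<close>

lemma majorant_bounds:
  assumes "r > 0" "M > 0"
  defines "t \<equiv> ln (1 + 1 / r)"
  shows "majorant r M n \<le> exp t / (r * t) * (M / t) ^ n * fact n"
    and "exp (- t) / (r * t) * (M / t) ^ n * fact n \<le> majorant r M n"
proof -
  have t: "t > 0" "r / (1 + r) = exp (- t)"
    unfolding t_def using exp_minus_ln_ratio[OF assms(1)] by blast+
  have "majorant r M n \<le> M ^ n / r * (exp t * (fact n / t ^ Suc n))"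
    unfolding majorant_def using assms by (intro mult_left_mono geometric_moment_le[OF t]) auto
  also have "\<dots> = exp t / (r * t) * (M / t) ^ n * fact n"
    by (simp add: power_divide mult_ac)
  finally show "majorant r M n \<le> exp t / (r * t) * (M / t) ^ n * fact n" .
  have "exp (- t) / (r * t) * (M / t) ^ n * fact n = M ^ n / r * (exp (- t) * (fact n / t ^ Suc n))"
    by (simp add: power_divide mult_ac)
  also have "\<dots> \<le> majorant r M n"
    unfolding majorant_def using assms by (intro mult_left_mono geometric_moment_ge[OF t]) auto
  finally show "exp (- t) / (r * t) * (M / t) ^ n * fact n \<le> majorant r M n" .
qed

section \<open>Growth of the composition inverse\<close>

text \<open>\<open>majorant_Suc\<close> mirrors \<open>comp_apply_Cons\<close> with a triangle
  inequality over the \<open>m\<close> components. Stripping a letter from \<open>a\<close> turns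
  \<open>A\<close> into \<open>A * M\<close>, so both are generalized. Bounding \<open>d\<close> on
  shorter words only permits \<open>d\<close> to be the inverse that is being estimated.\<close>

lemma comp_apply_abs_le:
  fixes d :: "'m::finite vseries"
  assumes "K > 0" "M > 0"
    and "\<And>\<xi> i. length \<xi> < length \<nu> \<Longrightarrow> \<bar>d \<xi> $ i\<bar> \<le> K * majorant (real CARD('m) * K) M (length \<xi>)"
    and "\<And>\<eta>. \<bar>a \<eta>\<bar> \<le> A * M ^ length \<eta>"
  shows "\<bar>comp_apply d a \<nu>\<bar> \<le> A * majorant (real CARD('m) * K) M (length \<nu>)"
  using assms(3,4)
proof (induction "length \<nu>" arbitrary: a A \<nu> rule: less_induct)
  case less
  let ?F = "majorant (real CARD('m) * K) M"
  have r: "real CARD('m) * K > 0"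
    using assms(1) by simp
  show ?case
  proof (cases \<nu>)
    case Nil
    then show ?thesis
      using less.prems(2)[of "[]"] by (simp add: comp_apply_Nil majorant_0[OF r])
  next
    case (Cons x \<mu>)
    have IH: "\<bar>comp_apply d (\<lambda>\<eta>. a (z # \<eta>)) \<xi>\<bar> \<le> A * M * ?F (length \<xi>)"
      if "length \<xi> \<le> length \<mu>" for z \<xi>
    proof (rule less.hyps)
      show "length \<xi> < length \<nu>"
        using that Cons by simp
      show "\<bar>d \<xi>' $ i\<bar> \<le> K * ?F (length \<xi>')" if "length \<xi>' < length \<xi>" for \<xi>' i
        using that \<open>length \<xi> < length \<nu>\<close> by (intro less.prems(1)) simp
      show "\<bar>a (z # \<eta>)\<bar> \<le> A * M * M ^ length \<eta>" for \<eta>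
        using less.prems(2)[of "z # \<eta>"] by simp
    qed
    have shuffle_le: "\<bar>shuffle (\<lambda>\<eta>. d \<eta> $ i) (comp_apply d (\<lambda>\<eta>. a (z # \<eta>))) \<mu>\<bar> \<le>
        K * (A * M) * binomial_conv ?F ?F (length \<mu>)" for i z
      unfolding binomial_conv_scale[symmetric]
      using Cons by (intro shuffle_abs_le IH less.prems(1)) auto
    \<comment> \<open>Serves the letters other than \<open>x\<^sub>0\<close>, for which the sum on
      the right is added although no shuffle term occurs.\<close>
    have conv_nonneg: "0 \<le> K * (A * M) * binomial_conv ?F ?F (length \<mu>)"
      using shuffle_le[of undefined undefined] by linarith
    have "\<bar>comp_apply d a \<nu>\<bar> \<le> \<bar>comp_apply d (\<lambda>\<eta>. a (x # \<eta>)) \<mu>\<bar> +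
        (\<Sum>i\<in>(UNIV :: 'm set). K * (A * M) * binomial_conv ?F ?F (length \<mu>))"
    proof (cases x)
      case None
      have "\<bar>\<Sum>i\<in>UNIV. shuffle (\<lambda>\<eta>. d \<eta> $ i) (comp_apply d (\<lambda>\<eta>. a (Some i # \<eta>))) \<mu>\<bar> \<le>
          (\<Sum>i\<in>(UNIV :: 'm set). K * (A * M) * binomial_conv ?F ?F (length \<mu>))"
        by (rule sum_abs[THEN order_trans]) (intro sum_mono shuffle_le)
      then show ?thesis
        using None Cons by (simp add: comp_apply_Cons)
    next
      case (Some i)
      then show ?thesis
        using Cons conv_nonneg by (simp add: comp_apply_Cons)
    qed
    also have "\<dots> \<le> A * M * ?F (length \<mu>) +
        (\<Sum>i\<in>(UNIV :: 'm set). K * (A * M) * binomial_conv ?F ?F (length \<mu>))"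
      using IH by simp
    also have "\<dots> = A * ?F (length \<nu>)"
      unfolding Cons length_Cons majorant_Suc[OF r] by (simp add: algebra_simps)
    finally show ?thesis .
  qed
qed

lemma comp_inverse_nth:
  "comp_inverse c \<nu> $ i = - comp_apply (comp_inverse c) (\<lambda>\<eta>. c \<eta> $ i) \<nu>"
  by (subst comp_inverse_eq) (simp add: mod_comp_nth)

lemma comp_inverse_abs_le:
  fixes c :: "'m::finite vseries"
  assumes "K > 0" "M > 0"
    and c: "\<And>\<eta>. infnorm (c \<eta>) \<le> K * M ^ length \<eta>"
  shows "\<bar>comp_inverse c \<nu> $ i\<bar> \<le> K * majorant (real CARD('m) * K) M (length \<nu>)"
proof (induction "length \<nu>" arbitrary: \<nu> i rule: less_induct)
  case less
  have "\<bar>comp_apply (comp_inverse c) (\<lambda>\<eta>. c \<eta> $ i) \<nu>\<bar> \<le> K * majorant (real CARD('m) * K) M (length \<nu>)"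
    using assms(1,2) less order_trans[OF component_le_infnorm_cart c]
    by (intro comp_apply_abs_le)
  then show ?case
    by (subst comp_inverse_nth) simp
qed

lemma infnorm_leI:
  fixes x :: "real ^ 'm::finite"
  assumes "\<And>i. \<bar>x $ i\<bar> \<le> B"
  shows "infnorm x \<le> B"
  unfolding infnorm_cart using assms by (intro cSup_least) auto

context
  fixes K M :: real
  assumes K: "K > 0" and M: "M > 0"
begin

lemma majorant_rate:
  "M / ln (1 + 1 / (real m * K)) = \<B> m K * M"
  by (simp add: \<B>_def)

lemma comp_inverse_growth:
  fixes c :: "'m::finite vseries"
  assumes "\<And>\<eta>. infnorm (c \<eta>) \<le> K * M ^ length \<eta>"
  shows "\<exists>L>0. \<forall>\<eta>. infnorm (comp_inverse c \<eta>) \<le> L * (\<B> CARD('m) K * M) ^ length \<eta> * fact (length \<eta>)"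
proof -
  let ?r = "real CARD('m) * K"
  let ?t = "ln (1 + 1 / ?r)"
  let ?L = "K * (exp ?t / (?r * ?t))"
  have r: "?r > 0"
    using K by simp
  have "?L > 0"
    using K exp_minus_ln_ratio(1)[OF r] by (intro mult_pos_pos divide_pos_pos) simp_all
  moreover have "infnorm (comp_inverse c \<eta>) \<le> ?L * (\<B> CARD('m) K * M) ^ length \<eta> * fact (length \<eta>)" for \<eta>
  proof (rule infnorm_leI)
    fix i
    have "\<bar>comp_inverse c \<eta> $ i\<bar> \<le> K * majorant ?r M (length \<eta>)"
      by (rule comp_inverse_abs_le[OF K M assms])
    also have "\<dots> \<le> K * (exp ?t / (?r * ?t) * (M / ?t) ^ length \<eta> * fact (length \<eta>))"
      using K by (intro mult_left_mono majorant_bounds(1)[OF r M]) simp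
    also have "\<dots> = ?L * (\<B> CARD('m) K * M) ^ length \<eta> * fact (length \<eta>)"
      unfolding majorant_rate by (simp only: mult.assoc)
    finally show "\<bar>comp_inverse c \<eta> $ i\<bar> \<le> ?L * (\<B> CARD('m) K * M) ^ length \<eta> * fact (length \<eta>)" .
  qed
  ultimately show ?thesis
    by blast
qed

section \<open>Sharpness of the growth constant\<close>

text \<open>The minus sign cancels the one in \<open>y = - mod_comp c y\<close>, so all terms of the
  recursion for \<open>y\<close> along powers of \<open>x\<^sub>0\<close> are positive and nothing
  is lost in the triangle inequality.\<close>

definition extremal_series :: "'m::finite vseries" where
  "extremal_series = (\<lambda>\<eta>. \<chi> i. - K * M ^ length \<eta>)"

lemma infnorm_extremal_series: "infnorm (extremal_series \<eta> :: real ^ 'm::finite) \<le> K * M ^ length \<eta>"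
  using K M by (intro infnorm_leI) (simp add: extremal_series_def abs_mult)

lemma comp_inverse_extremal_series:
  "comp_inverse (extremal_series :: 'm::finite vseries) (replicate n None) $ i =
     K * majorant (real CARD('m) * K) M n"
proof -
  let ?y = "comp_inverse (extremal_series :: 'm vseries)"
  let ?F = "majorant (real CARD('m) * K) M"
  define g where "g = comp_apply ?y (\<lambda>\<eta>. M ^ length \<eta>)"
  have r: "real CARD('m) * K > 0"
    using K by simp
  have y: "?y \<nu> $ i = K * g \<nu>" for \<nu> i
    using comp_apply_scale[of ?y "- K" "\<lambda>\<eta>. M ^ length \<eta>" \<nu>]
    by (subst comp_inverse_nth) (simp add: g_def extremal_series_def)
  have g_Cons: "g (None # \<nu>) = M * g \<nu> + real CARD('m) * K * M * shuffle g g \<nu>" for \<nu>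
  proof -
    \<comment> \<open>Every letter derives \<open>M ^ length \<eta>\<close> to \<open>M\<close>
      times itself, so the equation closes in the single series \<open>g\<close>.\<close>
    have shift: "comp_apply ?y (\<lambda>\<eta>. M ^ length (z # \<eta>)) = (\<lambda>\<eta>. M * g \<eta>)" for z :: "'m letter"
      by (simp add: g_def fun_eq_iff comp_apply_scale)
    have "shuffle (\<lambda>\<eta>. K * g \<eta>) (\<lambda>\<eta>. M * g \<eta>) \<nu> = K * M * shuffle g g \<nu>"
      by (simp add: shuffle_scale_right shuffle_commute[of "\<lambda>\<eta>. K * g \<eta>"])
    then show ?thesis
      unfolding g_def by (subst comp_apply_Cons) (simp only: shift y g_def[symmetric], simp)
  qed
  have "g (replicate n None) = ?F n" for n
  proof (induction n rule: less_induct)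
    case (less n)
    show ?case
    proof (cases n)
      case 0
      then show ?thesis
        by (simp add: g_def comp_apply_Nil majorant_0[OF r])
    next
      case (Suc l)
      have "binomial_conv (\<lambda>k. g (replicate k None)) (\<lambda>k. g (replicate k None)) l = binomial_conv ?F ?F l"
        unfolding binomial_conv_def by (intro sum.cong) (auto simp: less Suc)
      then show ?thesis
        using less[of l] by (simp add: Suc g_Cons shuffle_replicate majorant_Suc[OF r])
    qed
  qed
  then show ?thesis
    by (simp add: y)
qed

lemma comp_inverse_extremal_series_growth:
  assumes M': "0 < M'" "M' < \<B> CARD('m::finite) K * M"
  shows "\<not> (\<exists>L>0. \<forall>\<eta>. infnorm (comp_inverse (extremal_series :: 'm vseries) \<eta>)
    \<le> L * M' ^ length \<eta> * fact (length \<eta>))"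
proof
  let ?y = "comp_inverse (extremal_series :: 'm vseries)"
  let ?r = "real CARD('m) * K"
  let ?t = "ln (1 + 1 / ?r)"
  let ?C = "K * (exp (- ?t) / (?r * ?t))"
  let ?b = "\<B> CARD('m) K * M"
  assume "\<exists>L>0. \<forall>\<eta>. infnorm (?y \<eta>) \<le> L * M' ^ length \<eta> * fact (length \<eta>)"
  then obtain L where L: "\<And>\<eta>. infnorm (?y \<eta>) \<le> L * M' ^ length \<eta> * fact (length \<eta>)"
    by blast
  have r: "?r > 0"
    using K by simp
  have C: "?C > 0"
    using K exp_minus_ln_ratio(1)[OF r] by (intro mult_pos_pos divide_pos_pos) simp_all
  \<comment> \<open>On the words of \<open>n\<close> letters \<open>x\<^sub>0\<close> the factorials
    cancel, which leaves a bound on the powers of a number greater than 1.\<close>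
  have le: "(?b / M') ^ n \<le> L / ?C" for n
  proof -
    have "?C * ?b ^ n * fact n = K * (exp (- ?t) / (?r * ?t) * (M / ?t) ^ n * fact n)"
      unfolding majorant_rate by (simp only: mult.assoc)
    also have "\<dots> \<le> K * majorant ?r M n"
      using K by (intro mult_left_mono majorant_bounds(2)[OF r M]) simp
    \<comment> \<open>Any index serves here, as all components agree on these words.\<close>
    also have "\<dots> = ?y (replicate n None) $ undefined"
      by (rule comp_inverse_extremal_series[symmetric])
    also have "\<dots> \<le> infnorm (?y (replicate n None))"
      by (rule order_trans[OF abs_ge_self component_le_infnorm_cart])
    also have "\<dots> \<le> L * M' ^ n * fact n"
      using L[of "replicate n None"] by simp
    finally have "?C * ?b ^ n \<le> L * M' ^ n"
      by simp
    then show ?thesis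
      using C M'(1) by (simp add: power_divide pos_le_divide_eq pos_divide_le_eq mult.commute)
  qed
  have "1 < ?b / M'"
    using M' by simp
  then obtain n where "L / ?C < (?b / M') ^ n"
    using real_arch_pow by blast
  with le[of n] show False
    by linarith
qed

end

theorem theorem7:
  fixes K\<^sub>c M\<^sub>c :: real
  assumes "K\<^sub>c > 0" and "M\<^sub>c > 0"
  shows
    "(\<forall>c :: 'm::finite vseries.
        c \<in> GC_series \<and> (\<forall>\<eta>. infnorm (c \<eta>) \<le> K\<^sub>c * M\<^sub>c ^ length \<eta>) \<longrightarrow>
        (\<exists>K>0. \<forall>\<eta>. infnorm (comp_inverse c \<eta>)
            \<le> K * (\<B> CARD('m) K\<^sub>c * M\<^sub>c) ^ length \<eta> * fact (length \<eta>)) \<and>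
        comp_inverse c \<in> LC_series) \<and>
     (\<forall>M'. 0 < M' \<and> M' < \<B> CARD('m) K\<^sub>c * M\<^sub>c \<longrightarrow>
        (\<exists>c :: 'm vseries. c \<in> GC_series \<and> (\<forall>\<eta>. infnorm (c \<eta>) \<le> K\<^sub>c * M\<^sub>c ^ length \<eta>) \<and>
          \<not> (\<exists>K>0. \<forall>\<eta>. infnorm (comp_inverse c \<eta>)
                \<le> K * M' ^ length \<eta> * fact (length \<eta>)))) \<and>
     has_radius_of_convergence
       (comp_inverse ` {c :: 'm vseries. c \<in> GC_series \<and>
          (\<forall>\<eta>. infnorm (c \<eta>) \<le> K\<^sub>c * M\<^sub>c ^ length \<eta>)})
       (1 / (\<B> CARD('m) K\<^sub>c * M\<^sub>c * (real CARD('m) + 1)))"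
proof -
  let ?b = "\<B> CARD('m) K\<^sub>c * M\<^sub>c"
  let ?C = "{c :: 'm vseries. c \<in> GC_series \<and> (\<forall>\<eta>. infnorm (c \<eta>) \<le> K\<^sub>c * M\<^sub>c ^ length \<eta>)}"
  let ?bound = "\<lambda>(c :: 'm vseries) M. \<exists>K>0. \<forall>\<eta>. infnorm (comp_inverse c \<eta>) \<le> K * M ^ length \<eta> * fact (length \<eta>)"
  have r: "real CARD('m) * K\<^sub>c > 0"
    using assms by simp
  then have b: "?b > 0"
    unfolding \<B>_def using assms exp_minus_ln_ratio(1)[OF r] by simp
  have growth: "?bound c ?b" if "c \<in> ?C" for c
    using that comp_inverse_growth[OF assms, of c] by blast
  then have LC: "comp_inverse c \<in> LC_series" if "c \<in> ?C" for c
    using that b unfolding LC_series_def by blast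
  have sharp: "\<exists>c\<in>?C. \<not> ?bound c M'" if "0 < M'" "M' < ?b" for M'
  proof
    show "extremal_series K\<^sub>c M\<^sub>c \<in> ?C"
      using infnorm_extremal_series[OF assms, where 'm = 'm] assms unfolding GC_series_def by blast
    show "\<not> ?bound (extremal_series K\<^sub>c M\<^sub>c) M'"
      by (rule comp_inverse_extremal_series_growth[OF assms that])
  qed
  have "geometric_growth_constant (comp_inverse ` ?C) ?b"
    unfolding geometric_growth_constant_def using b growth by blast
  moreover have "?b \<le> M'" if "geometric_growth_constant (comp_inverse ` ?C) M'" for M'
    using that sharp[of M'] unfolding geometric_growth_constant_def by (meson imageI not_le)
  ultimately have "has_radius_of_convergence (comp_inverse ` ?C) (1 / (?b * (real CARD('m) + 1)))"
    unfolding has_radius_of_convergence_def by blast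
  then show ?thesis
    using growth LC sharp by blast
qed

end
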